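(* Let $N\ge 1$ and let $(U_1,\mathscr{B}_1),\dots,(U_N,\mathscr{B}_N)$ be measurable spaces with each $U_i$ nonempty and with $\{u_i\}\in\mathscr{B}_i$ for every $u_i\in U_i$, $i=1,\dots,N$. Put $U=U_1\times\dots\times U_N$. For each $i$ let $\Gamma_i$ be a set of probability measures on $\mathscr{B}_i$ and $\Gamma_i^*$ the set of all degenerate probability measures on $\mathscr{B}_i$; put $\Gamma=\{(\Psi_1,\dots,\Psi_N):\Psi_i\in\Gamma_i,\ i=1,\dots,N\}$ and $\Gamma^*=\{(\Psi_1^*,\dots,\Psi_N^* ):\Psi_i^*\in\Gamma_i^*,\ i=1,\dots,N\}$. Let $A,B:U\to\mathbb{R}$ be measurable (with respect to the product $\sigma$-algebra) and assume: (a) for every $\Psi=(\Psi_1,\dots,\Psi_N)\in\Gamma$ the integrals $I_1(\Psi)=\int_{U_1}\cdots\int_{U_N}A\,d\Psi_1\cdots d\Psi_N$ and $I_2(\Psi)=\int_{U_1}\cdots\int_{U_N}B\,d\Psi_1\cdots d\Psi_N$ are defined (as real numbers); (b) $\Gamma_i^*\subset\Gamma_i$ for all $i$, so that $\Gamma^*\subset\Gamma$; (c) $B$ is strictly of constant sign on $U$ (either $B(u)>0$ for all $u\in U$, or $B(u)<0$ for all $u\in U$). Let $I(\Psi)=I_1(\Psi)/I_2(\Psi)$ for $\Psi\in\Gamma$, and let $C(u)=A(u)/B(u)$ for $u=(u_1,\dots,u_N)\in U$. Then the following assertions hold. (1) If $C$ is bounded above and attains its global maximum on $U$ at a point $u^{(+)}=(u_1^{(+)},\dots,u_N^{(+)})\in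 U$, then the maximum of $I$ over $\Gamma$ exists and is attained at $\Psi^{*(+)}=(\Psi_1^{*(+)},\dots,\Psi_N^{*(+)})\in\Gamma^*$, where $\Psi_i^{*(+)}$ is the degenerate measure concentrated at $u_i^{(+)}$, and $$\max_{\Psi\in\Gamma}I(\Psi)=\max_{\Psi^*\in\Gamma^*}I(\Psi^* )=I(\Psi^{*(+)})=\max_{u\in U}\frac{A(u)}{B(u)}=\frac{A(u^{(+)})}{B(u^{(+)})}.$$ Similarly, if $C$ is bounded below and attains its global minimum on $U$ at a point $u^{(-)}=(u_1^{(-)},\dots,u_N^{(-)})\in U$, then the minimum of $I$ over $\Gamma$ exists and is attained at $\Psi^{*(-)}=(\Psi_1^{*(-)},\dots,\Psi_N^{*(-)})\in\Gamma^*$, where $\Psi_i^{*(-)}$ is the degenerate measure concentrated at $u_i^{(-)}$, and $$\min_{\Psi\in\Gamma}I(\Psi)=\min_{\Psi^*\in\Gamma^*}I(\Psi^* )=I(\Psi^{*(-)})=\min_{u\in U}\frac{A(u)}{B(u)}=\frac{A(u^{(-)})}{B(u^{(-)})}.$$ (2) If $C$ is bounded above but does not attain a global maximum on $U$, then for every $\varepsilon>0$ there is an $\varepsilon$-optimal (for the maximum problem) collection of degenerate probability measures $\Psi^{*(+)}(\varepsilon)=(\Psi_1^{*(+)}(\varepsilon),\dots,\Psi_N^{*(+)}(\varepsilon))\in\Gamma^*$; namely, one may take $\Psi_i^{*(+)}(\varepsilon)$ concentrated at $u_i^{(+)}(\varepsilon)$, where $u^{(+)}(\varepsilon)=(u_1^{(+)}(\varepsilon),\dots,u_N^{(+)}(\varepsilon))\in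 U$ is an arbitrary point (such points exist) with $$\sup_{u\in U}\frac{A(u)}{B(u)}-\varepsilon<\frac{A(u^{(+)}(\varepsilon))}{B(u^{(+)}(\varepsilon))}<\sup_{u\in U}\frac{A(u)}{B(u)}<\infty.$$ Similarly, if $C$ is bounded below but does not attain a global minimum on $U$, then for every $\varepsilon>0$ there is an $\varepsilon$-optimal (for the minimum problem) collection $\Psi^{*(-)}(\varepsilon)=(\Psi_1^{*(-)}(\varepsilon),\dots,\Psi_N^{*(-)}(\varepsilon))\in\Gamma^*$; namely, one may take $\Psi_i^{*(-)}(\varepsilon)$ concentrated at $u_i^{(-)}(\varepsilon)$, where $u^{(-)}(\varepsilon)\in U$ is an arbitrary point (such points exist) with $$-\infty<\inf_{u\in U}\frac{A(u)}{B(u)}<\frac{A(u^{(-)}(\varepsilon))}{B(u^{(-)}(\varepsilon))}<\inf_{u\in U}\frac{A(u)}{B(u)}+\varepsilon.$$ (3) If $C$ is not bounded above, then $I$ has no maximum over $\Gamma$, and there exists a sequence $\Psi^{*(+)}(n)=(\Psi_1^{*(+)}(n),\dots,\Psi_N^{*(+)}(n))\in\Gamma^*$, $n=1,2,\dots$, with $\Psi_i^{*(+)}(n)$ concentrated at a point $u_i^{(+)}(n)\in U_i$, such that $$I(\Psi^{*(+)}(n))=\frac{A(u_1^{(+)}(n),\dots,u_N^{(+)}(n))}{B(u_1^{(+)}(n),\dots,u_N^{(+)}(n))}\to\infty\quad\text{as }n\to\infty.$$ Similarly, if $C$ is not bounded below, then $I$ has no minimum over $\Gamma$, and there exists a sequence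 $\Psi^{*(-)}(n)=(\Psi_1^{*(-)}(n),\dots,\Psi_N^{*(-)}(n))\in\Gamma^*$, $n=1,2,\dots$, with $\Psi_i^{*(-)}(n)$ concentrated at a point $u_i^{(-)}(n)\in U_i$, such that $$I(\Psi^{*(-)}(n))=\frac{A(u_1^{(-)}(n),\dots,u_N^{(-)}(n))}{B(u_1^{(-)}(n),\dots,u_N^{(-)}(n))}\to-\infty\quad\text{as }n\to\infty.$$
   Context: A probability measure $\Psi^*$ on a measurable space $(V,\mathscr{V})$ whose $\sigma$-algebra contains all singletons is called degenerate, with concentration point $v^*\in V$, if $\Psi^*(\{v^*\})=1$ and $\Psi^*(V\setminus\{v^*\})=0$. A collection $(\Psi_1,\dots,\Psi_N)$ is identified with the product measure $\Psi_1\times\dots\times\Psi_N$ on $U$ with the product $\sigma$-algebra $\mathscr{B}_1\times\dots\times\mathscr{B}_N$; the multiple integrals are Lebesgue integrals with respect to this product measure. Condition (c) guarantees $I_2(\Psi)\ne0$ for all $\Psi\in\Gamma$, so $I$ is well defined; $I$ is called a linear-fractional integral functional and $C$ its test function. $\varepsilon$-optimality: $\Psi'\in\Gamma$ is $\varepsilon$-optimal for the maximum problem if $I(\Psi')>\sup_{\Psi\in\Gamma}I(\Psi)-\varepsilon$, where the supremum is finite; it is $\varepsilon$-optimal for the minimum problem if $I(\Psi')<\inf_{\Psi\in\Gamma}I(\Psi)+\varepsilon$, where the infimum is finite. *)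

theory Defs
  imports "HOL-Probability.Probability"
begin

text \<open>A measurable space is represented by a value \<open>M\<close> of type \<open>'a measure\<close> of which only
  \<open>space M\<close> and \<open>sets M\<close> are used.\<close>

definition degenerate_at :: "'a measure \<Rightarrow> 'a \<Rightarrow> 'a measure \<Rightarrow> bool" where
  "degenerate_at M v P \<longleftrightarrow>
     prob_space P \<and> sets P = sets M \<and> v \<in> space M \<and>
     measure P {v} = 1 \<and> measure P (space M - {v}) = 0"

definition degenerate_measures :: "'a measure \<Rightarrow> 'a measure set" where
  "degenerate_measures M = {P. \<exists>v\<in>space M. degenerate_at M v P}"

text \<open>When singletons are measurable, the degenerate measure concentrated at a given point
  is unique, namely the Dirac measure \<open>return M v\<close>.\<close>

lemma degenerate_at_iff_return:
  assumes "v \<in> space M" and "{v} \<in> sets M"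
  shows "degenerate_at M v P \<longleftrightarrow> P = return M v"
proof
  assume deg: "degenerate_at M v P"
  then interpret prob_space P by (simp add: degenerate_at_def)
  have sets_P: "sets P = sets M" and m1: "measure P {v} = 1"
    using deg by (auto simp: degenerate_at_def)
  have ae: "AE x in P. x = v"
    using AE_in_set_eq_1[of "{v}"] assms sets_P m1 by simp
  show "P = return M v"
  proof (rule measure_eqI)
    fix X assume X: "X \<in> sets P"
    have "emeasure P X = indicator X v"
    proof (cases "v \<in> X")
      case True
      have "AE x in P. x \<in> X" using ae True by auto
      then show ?thesis using X True by (simp add: emeasure_eq_1_AE)
    next
      case False
      have "AE x in P. x \<notin> X" using ae False by auto
      then have "emeasure P X = 0" using X by (subst (asm) AE_iff_measurable[of X])
          (auto dest: sets.sets_into_space)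
      then show ?thesis using False by simp
    qed
    then show "emeasure P X = emeasure (return M v) X" using X sets_P by simp
  qed (simp add: sets_P)
next
  assume "P = return M v"
  then show "degenerate_at M v P"
    using assms by (simp add: degenerate_at_def prob_space_return measure_return)
qed

definition dirac_collection :: "nat \<Rightarrow> (nat \<Rightarrow> 'a measure) \<Rightarrow> (nat \<Rightarrow> 'a) \<Rightarrow> (nat \<Rightarrow> 'a measure)" where
  "dirac_collection N M u = (\<lambda>i\<in>{1..N}. return (M i) (u i))"

definition linear_fractional ::
    "nat \<Rightarrow> ((nat \<Rightarrow> 'a) \<Rightarrow> real) \<Rightarrow> ((nat \<Rightarrow> 'a) \<Rightarrow> real) \<Rightarrow> (nat \<Rightarrow> 'a measure) \<Rightarrow> real" where
  "linear_fractional N A B \<Psi> =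
     (\<integral>u. A u \<partial>(PiM {1..N} \<Psi>)) / (\<integral>u. B u \<partial>(PiM {1..N} \<Psi>))"

definition test_function ::
    "((nat \<Rightarrow> 'a) \<Rightarrow> real) \<Rightarrow> ((nat \<Rightarrow> 'a) \<Rightarrow> real) \<Rightarrow> (nat \<Rightarrow> 'a) \<Rightarrow> real" where
  "test_function A B u = A u / B u"

definition is_max_value :: "('b \<Rightarrow> real) \<Rightarrow> 'b set \<Rightarrow> real \<Rightarrow> bool" where
  "is_max_value f S m \<longleftrightarrow> m \<in> f ` S \<and> (\<forall>x\<in>S. f x \<le> m)"

definition is_min_value :: "('b \<Rightarrow> real) \<Rightarrow> 'b set \<Rightarrow> real \<Rightarrow> bool" where
  "is_min_value f S m \<longleftrightarrow> m \<in> f ` S \<and> (\<forall>x\<in>S. m \<le> f x)"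

text \<open>The boundedness conjuncts express finiteness of the supremum and infimum; without them
  \<open>SUP\<close> and \<open>INF\<close> on the reals are unspecified.\<close>

definition eps_optimal_max :: "('b \<Rightarrow> real) \<Rightarrow> 'b set \<Rightarrow> real \<Rightarrow> 'b \<Rightarrow> bool" where
  "eps_optimal_max f S \<epsilon> x \<longleftrightarrow> x \<in> S \<and> bdd_above (f ` S) \<and> f x > (SUP y\<in>S. f y) - \<epsilon>"

definition eps_optimal_min :: "('b \<Rightarrow> real) \<Rightarrow> 'b set \<Rightarrow> real \<Rightarrow> 'b \<Rightarrow> bool" where
  "eps_optimal_min f S \<epsilon> x \<longleftrightarrow> x \<in> S \<and> bdd_below (f ` S) \<and> f x < (INF y\<in>S. f y) + \<epsilon>"

end

theory Submission
  imports Defs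
begin

text \<open>If \<open>A u / B u \<le> m\<close> on \<open>U\<close> and \<open>B > 0\<close>, then integrating \<open>A \<le> m B\<close> gives \<open>I \<Psi> \<le> m\<close>, so the values
  of \<open>I\<close> are bounded by every upper bound of \<open>C\<close>. Conversely, at a collection of Dirac measures
  the product measure is the Dirac measure at \<open>u\<close>, so there \<open>I\<close> takes the value \<open>C u\<close>. The
  assertions on maxima and suprema are order-theoretic consequences of these two facts; those on
  minima follow by passing to \<open>- A\<close>.\<close>

section \<open>Integrating a pointwise bound on the quotient\<close>

lemma linear_fractional_le:
  assumes prob: "\<And>i. i \<in> {1..N} \<Longrightarrow> prob_space (\<Psi> i)"
    and A: "integrable (PiM {1..N} \<Psi>) A" and B: "integrable (PiM {1..N} \<Psi>) B"
    and sign: "(\<forall>u\<in>space (PiM {1..N} \<Psi>). B u > 0) \<or> (\<forall>u\<in>space (PiM {1..N} \<Psi>). B u < 0)"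
    and le: "\<And>u. u \<in> space (PiM {1..N} \<Psi>) \<Longrightarrow> A u / B u \<le> m"
  shows "linear_fractional N A B \<Psi> \<le> m"
proof -
  interpret prob_space "PiM {1..N} \<Psi>"
    by (intro prob_space_PiM prob)
  from sign show ?thesis
  proof
    assume pos: "\<forall>u\<in>space (PiM {1..N} \<Psi>). B u > 0"
    \<comment> \<open>The strict pointwise sign survives integration against a probability measure,
      so the inequality between integrals may be divided by \<open>expectation B\<close>.\<close>
    have "expectation B > 0"
      by (intro expectation_greater B AE_I2) (use pos in auto)
    moreover have "expectation A \<le> expectation (\<lambda>u. m * B u)"
      by (intro integral_mono A integrable_mult_right B)
        (use le pos in \<open>auto simp: pos_divide_le_eq\<close>)
    ultimately show ?thesis
      by (simp add: linear_fractional_def pos_divide_le_eq)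
  next
    assume neg: "\<forall>u\<in>space (PiM {1..N} \<Psi>). B u < 0"
    have "expectation B < 0"
      by (intro expectation_less B AE_I2) (use neg in auto)
    \<comment> \<open>Clearing a negative denominator reverses the inequality; the final division by
      the negative \<open>expectation B\<close> reverses it back.\<close>
    moreover have "expectation (\<lambda>u. m * B u) \<le> expectation A"
      by (intro integral_mono A integrable_mult_right B)
        (use le neg in \<open>auto simp: neg_divide_le_eq\<close>)
    ultimately show ?thesis
      by (simp add: linear_fractional_def neg_divide_le_eq)
  qed
qed

text \<open>Only the numerator changes sign, so minima can be reduced to maxima while the sign
  condition on \<open>B\<close> is kept.\<close>

lemma linear_fractional_uminus:
  "linear_fractional N (\<lambda>u. - A u) B \<Psi> = - linear_fractional N A B \<Psi>"
  by (simp add: linear_fractional_def)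

section \<open>Products of point masses\<close>

lemma PiM_dirac_collection:
  assumes u: "u \<in> space (PiM {1..N} M)"
    and single: "\<And>i x. i \<in> {1..N} \<Longrightarrow> x \<in> space (M i) \<Longrightarrow> {x} \<in> sets (M i)"
  shows "PiM {1..N} (dirac_collection N M u) = return (PiM {1..N} M) u"
proof -
  have "PiM {1..N} (dirac_collection N M u) = PiM {1..N} (\<lambda>i. return (M i) (u i))"
    by (intro PiM_cong) (auto simp: dirac_collection_def)
  also have "\<dots> = return (PiM {1..N} M) (restrict u {1..N})"
    using u single by (intro PiM_return) (auto simp: space_PiM PiE_iff)
  \<comment> \<open>Points of the product space are extensional on \<open>{1..N}\<close>.\<close>
  also have "restrict u {1..N} = u"
    using u by (simp add: space_PiM PiE_restrict)
  finally show ?thesis .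
qed

text \<open>Integrating a measurable function against the point mass at \<open>u\<close> evaluates
  it at \<open>u\<close>, in the numerator and in the denominator.\<close>

lemma linear_fractional_dirac_collection:
  assumes "u \<in> space (PiM {1..N} M)"
    and "\<And>i x. i \<in> {1..N} \<Longrightarrow> x \<in> space (M i) \<Longrightarrow> {x} \<in> sets (M i)"
    and "A \<in> borel_measurable (PiM {1..N} M)" "B \<in> borel_measurable (PiM {1..N} M)"
  shows "linear_fractional N A B (dirac_collection N M u) = A u / B u"
proof -
  have "PiM {1..N} (dirac_collection N M u) = return (PiM {1..N} M) u"
    using assms(1,2) by (rule PiM_dirac_collection)
  with assms show ?thesis
    by (simp only: linear_fractional_def integral_return)
qed

lemma degenerate_at_dirac_collection:
  assumes "u \<in> space (PiM {1..N} M)"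
    and "\<And>i x. i \<in> {1..N} \<Longrightarrow> x \<in> space (M i) \<Longrightarrow> {x} \<in> sets (M i)"
    and "i \<in> {1..N}"
  shows "degenerate_at (M i) (u i) (dirac_collection N M u i)"
proof -
  have "u i \<in> space (M i)"
    using assms by (auto simp: space_PiM)
  then show ?thesis
    using assms by (simp add: degenerate_at_iff_return dirac_collection_def)
qed

lemma dirac_collection_mem_degenerate:
  assumes "u \<in> space (PiM {1..N} M)"
    and "\<And>i x. i \<in> {1..N} \<Longrightarrow> x \<in> space (M i) \<Longrightarrow> {x} \<in> sets (M i)"
  shows "dirac_collection N M u \<in> PiE {1..N} (\<lambda>i. degenerate_measures (M i))"
proof (rule PiE_I)
  fix i assume i: "i \<in> {1..N}"
  then have "u i \<in> space (M i)"
    using assms(1) by (auto simp: space_PiM)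
  then show "dirac_collection N M u i \<in> degenerate_measures (M i)"
    using degenerate_at_dirac_collection[OF assms i] by (auto simp: degenerate_measures_def)
\<comment> \<open>Outside \<open>{1..N}\<close> the collection is \<open>undefined\<close>, as
  membership in \<open>PiE\<close> demands.\<close>
qed (auto simp: dirac_collection_def)

section \<open>Order-theoretic transfer of maxima and suprema\<close>

text \<open>Here \<open>S\<close> stands for all collections, \<open>T\<close> for the degenerate
  ones and \<open>D\<close> for the passage from points to point masses. Keeping \<open>I\<close>
  and \<open>C\<close> as parameters allows a second instance with both negated. The bound
  \<open>m\<close> in \<open>I_le\<close> is arbitrary, so that it can be an attained maximum or
  merely a supremum.\<close>

locale max_transfer =
  fixes I :: "'b \<Rightarrow> real" and S T :: "'b set" and C :: "'c \<Rightarrow> real" and U :: "'c set"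
    and D :: "'c \<Rightarrow> 'b"
  assumes D_mem: "u \<in> U \<Longrightarrow> D u \<in> T"
    and T_subset: "T \<subseteq> S"
    and I_D: "u \<in> U \<Longrightarrow> I (D u) = C u"
    and I_le: "x \<in> S \<Longrightarrow> (\<And>u. u \<in> U \<Longrightarrow> C u \<le> m) \<Longrightarrow> I x \<le> m"
    and U_nonempty: "U \<noteq> {}"
begin

lemma D_mem_S: "u \<in> U \<Longrightarrow> D u \<in> S"
  using D_mem T_subset by blast

text \<open>A maximal value \<open>C u\<close> bounds \<open>I\<close> on \<open>S\<close> by
  \<open>I_le\<close>, and \<open>D u\<close> attains it. Since \<open>D u\<close> lies in
  \<open>T\<close>, the same value is the maximum over the smaller set.\<close>

lemma arg_max:
  assumes "is_arg_max C (\<lambda>v. v \<in> U) u"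
  shows "is_arg_max I (\<lambda>x. x \<in> S) (D u)" "is_max_value I S (I (D u))"
    "is_max_value I T (I (D u))" "is_max_value C U (I (D u))"
proof -
  have u: "u \<in> U" and max: "\<And>v. v \<in> U \<Longrightarrow> C v \<le> C u"
    using assms by (auto simp: is_arg_max_linorder)
  have le: "I x \<le> I (D u)" if "x \<in> S" for x
    using that max I_le[of x "C u"] by (simp add: I_D u)
  show "is_arg_max I (\<lambda>x. x \<in> S) (D u)"
    using u le D_mem_S by (auto simp: is_arg_max_linorder)
  show "is_max_value I S (I (D u))" "is_max_value I T (I (D u))"
    using u le D_mem D_mem_S T_subset by (auto simp: is_max_value_def)
  show "is_max_value C U (I (D u))"
    using u max by (auto simp: is_max_value_def I_D)
qed

text \<open>The supremum of \<open>I\<close> is at most that of \<open>C\<close>, and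
  \<open>I (D u)\<close> equals \<open>C u\<close>, so nearness to the supremum passes from
  \<open>u\<close> to \<open>D u\<close>.\<close>

lemma eps_optimal:
  assumes bdd: "bdd_above (C ` U)" and u: "u \<in> U" "(SUP v\<in>U. C v) - \<epsilon> < C u"
  shows "eps_optimal_max I S \<epsilon> (D u)"
proof -
  have le: "I x \<le> (SUP v\<in>U. C v)" if "x \<in> S" for x
    using that bdd by (intro I_le cSUP_upper)
  \<comment> \<open>The point \<open>D u\<close> witnesses that \<open>S\<close> is nonempty, as
    \<open>cSUP_least\<close> requires.\<close>
  then have "(SUP x\<in>S. I x) \<le> (SUP v\<in>U. C v)"
    using D_mem_S u(1) by (intro cSUP_least) auto
  moreover have "bdd_above (I ` S)"
    using le by (rule bdd_aboveI2)
  ultimately show ?thesis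
    using u D_mem_S by (simp add: eps_optimal_max_def I_D)
qed

text \<open>Without a maximizer every value of \<open>C\<close> is exceeded by another one, which is
  itself at most the supremum.\<close>

lemma less_SUP:
  assumes bdd: "bdd_above (C ` U)" and "\<not> (\<exists>u. is_arg_max C (\<lambda>v. v \<in> U) u)" and u: "u \<in> U"
  shows "C u < (SUP v\<in>U. C v)"
proof -
  obtain v where "v \<in> U" "C u < C v"
    using assms by (auto simp: is_arg_max_def)
  with cSUP_upper[OF _ bdd, of v] show ?thesis by simp
qed

lemma near_SUP:
  assumes "bdd_above (C ` U)" and "\<not> (\<exists>u. is_arg_max C (\<lambda>v. v \<in> U) u)" and "\<epsilon> > 0"
  shows "\<exists>u\<in>U. (SUP v\<in>U. C v) - \<epsilon> < C u \<and> C u < (SUP v\<in>U. C v)"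
proof -
  have "\<exists>u\<in>U. (SUP v\<in>U. C v) - \<epsilon> < C u"
    using assms(3) less_cSUP_iff[OF U_nonempty assms(1), of "(SUP v\<in>U. C v) - \<epsilon>"] by simp
  then show ?thesis
    using less_SUP[OF assms(1,2)] by blast
qed

text \<open>The value of \<open>I\<close> at a maximizer would bound all \<open>I (D u)\<close>,
  that is, all values of \<open>C\<close>.\<close>

lemma no_arg_max:
  assumes "\<not> bdd_above (C ` U)"
  shows "\<not> is_arg_max I (\<lambda>x. x \<in> S) x"
proof
  assume max: "is_arg_max I (\<lambda>x. x \<in> S) x"
  have "C u \<le> I x" if "u \<in> U" for u
    using max that D_mem_S by (force simp: is_arg_max_linorder simp flip: I_D)
  then have "bdd_above (C ` U)"
    by (rule bdd_aboveI2)
  with assms show False ..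
qed

lemma unbounded_sequence:
  assumes "\<not> bdd_above (C ` U)"
  shows "\<exists>u :: nat \<Rightarrow> 'c. (\<forall>n. u n \<in> U) \<and> filterlim (\<lambda>n. I (D (u n))) at_top sequentially"
proof -
  \<comment> \<open>Each natural number fails to be an upper bound; comparison with the sequence
    \<open>real n\<close> then gives divergence.\<close>
  have "\<exists>v. v \<in> U \<and> real n \<le> C v" for n
    using assms unfolding bdd_above_def by (auto simp: not_le intro: less_imp_le)
  then obtain u where u: "\<And>n. u n \<in> U" "\<And>n. real n \<le> C (u n)"
    by metis
  have "filterlim (\<lambda>n. I (D (u n))) at_top sequentially"
    using u by (intro filterlim_at_top_mono[OF filterlim_real_sequentially]) (simp add: I_D)
  with u show ?thesis by blast
qed

end

section \<open>Reduction of minima to maxima by a change of sign\<close>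

lemma is_arg_min_iff_uminus: "is_arg_min f P x \<longleftrightarrow> is_arg_max (\<lambda>y. - f y :: real) P x"
  by (simp add: is_arg_min_def is_arg_max_def)

lemma is_min_value_iff_uminus: "is_min_value f S m \<longleftrightarrow> is_max_value (\<lambda>y. - f y) S (- m)"
  by (auto simp: is_min_value_def is_max_value_def)

text \<open>On the reals \<open>Inf\<close> is defined as the negated \<open>Sup\<close> of the
  negated set, so the identity also covers sets where both are unspecified.\<close>

lemma INF_eq_uminus_SUP: "(INF y\<in>S. f y :: real) = - (SUP y\<in>S. - f y)"
  by (simp add: Inf_real_def image_image)

lemma eps_optimal_min_iff_uminus:
  "eps_optimal_min f S \<epsilon> x \<longleftrightarrow> eps_optimal_max (\<lambda>y. - f y) S \<epsilon> x"
  by (auto simp: eps_optimal_min_def eps_optimal_max_def INF_eq_uminus_SUP bdd_above_uminus_image)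

section \<open>Extrema of the linear-fractional functional over collections of measures\<close>

theorem theorem1:
  fixes N :: nat
    and M :: "nat \<Rightarrow> 'a measure"
    and \<Gamma> :: "nat \<Rightarrow> 'a measure set"
    and A B :: "(nat \<Rightarrow> 'a) \<Rightarrow> real"
  assumes "N \<ge> 1"
    and "\<And>i. i \<in> {1..N} \<Longrightarrow> space (M i) \<noteq> {}"
    and "\<And>i x. i \<in> {1..N} \<Longrightarrow> x \<in> space (M i) \<Longrightarrow> {x} \<in> sets (M i)"
    and "\<And>i P. i \<in> {1..N} \<Longrightarrow> P \<in> \<Gamma> i \<Longrightarrow> prob_space P \<and> sets P = sets (M i)"
    and "A \<in> borel_measurable (PiM {1..N} M)"
    and "B \<in> borel_measurable (PiM {1..N} M)"
    and "\<And>\<Psi>. \<Psi> \<in> PiE {1..N} \<Gamma> \<Longrightarrow>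
           integrable (PiM {1..N} \<Psi>) A \<and> integrable (PiM {1..N} \<Psi>) B"
    and "\<And>i. i \<in> {1..N} \<Longrightarrow> degenerate_measures (M i) \<subseteq> \<Gamma> i"
    and "(\<forall>u\<in>space (PiM {1..N} M). B u > 0) \<or> (\<forall>u\<in>space (PiM {1..N} M). B u < 0)"
  shows
    "let U = space (PiM {1..N} M);
         \<Gamma>s = PiE {1..N} \<Gamma>;
         \<Gamma>d = PiE {1..N} (\<lambda>i. degenerate_measures (M i));
         I = linear_fractional N A B;
         C = test_function A B;
         D = dirac_collection N M
     in
       (\<forall>u. bdd_above (C ` U) \<and> is_arg_max C (\<lambda>v. v \<in> U) u \<longrightarrow>
          D u \<in> \<Gamma>d \<and> (\<forall>i\<in>{1..N}. degenerate_at (M i) (u i) (D u i)) \<and>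
          is_arg_max I (\<lambda>\<Psi>. \<Psi> \<in> \<Gamma>s) (D u) \<and>
          is_max_value I \<Gamma>s (I (D u)) \<and>
          is_max_value I \<Gamma>d (I (D u)) \<and>
          is_max_value C U (I (D u)) \<and>
          I (D u) = A u / B u) \<and>
       (\<forall>u. bdd_below (C ` U) \<and> is_arg_min C (\<lambda>v. v \<in> U) u \<longrightarrow>
          D u \<in> \<Gamma>d \<and> (\<forall>i\<in>{1..N}. degenerate_at (M i) (u i) (D u i)) \<and>
          is_arg_min I (\<lambda>\<Psi>. \<Psi> \<in> \<Gamma>s) (D u) \<and>
          is_min_value I \<Gamma>s (I (D u)) \<and>
          is_min_value I \<Gamma>d (I (D u)) \<and>
          is_min_value C U (I (D u)) \<and>
          I (D u) = A u / B u) \<and>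
       (bdd_above (C ` U) \<and> \<not> (\<exists>u. is_arg_max C (\<lambda>v. v \<in> U) u) \<longrightarrow>
          (\<forall>\<epsilon>>0.
             (\<exists>\<Psi>\<in>\<Gamma>d. eps_optimal_max I \<Gamma>s \<epsilon> \<Psi>) \<and>
             (\<exists>u\<in>U. (SUP v\<in>U. C v) - \<epsilon> < C u \<and> C u < (SUP v\<in>U. C v)) \<and>
             (\<forall>u\<in>U. (SUP v\<in>U. C v) - \<epsilon> < C u \<and> C u < (SUP v\<in>U. C v) \<longrightarrow>
                D u \<in> \<Gamma>d \<and> (\<forall>i\<in>{1..N}. degenerate_at (M i) (u i) (D u i)) \<and>
                eps_optimal_max I \<Gamma>s \<epsilon> (D u)))) \<and>
       (bdd_below (C ` U) \<and> \<not> (\<exists>u. is_arg_min C (\<lambda>v. v \<in> U) u) \<longrightarrow>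
          (\<forall>\<epsilon>>0.
             (\<exists>\<Psi>\<in>\<Gamma>d. eps_optimal_min I \<Gamma>s \<epsilon> \<Psi>) \<and>
             (\<exists>u\<in>U. (INF v\<in>U. C v) < C u \<and> C u < (INF v\<in>U. C v) + \<epsilon>) \<and>
             (\<forall>u\<in>U. (INF v\<in>U. C v) < C u \<and> C u < (INF v\<in>U. C v) + \<epsilon> \<longrightarrow>
                D u \<in> \<Gamma>d \<and> (\<forall>i\<in>{1..N}. degenerate_at (M i) (u i) (D u i)) \<and>
                eps_optimal_min I \<Gamma>s \<epsilon> (D u)))) \<and>
       (\<not> bdd_above (C ` U) \<longrightarrow>
          \<not> (\<exists>\<Psi>. is_arg_max I (\<lambda>\<Psi>. \<Psi> \<in> \<Gamma>s) \<Psi>) \<and>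
          (\<exists>u :: nat \<Rightarrow> nat \<Rightarrow> 'a.
             (\<forall>n\<ge>1. u n \<in> U \<and> D (u n) \<in> \<Gamma>d \<and>
                (\<forall>i\<in>{1..N}. degenerate_at (M i) (u n i) (D (u n) i)) \<and>
                I (D (u n)) = A (u n) / B (u n)) \<and>
             filterlim (\<lambda>n. I (D (u n))) at_top sequentially)) \<and>
       (\<not> bdd_below (C ` U) \<longrightarrow>
          \<not> (\<exists>\<Psi>. is_arg_min I (\<lambda>\<Psi>. \<Psi> \<in> \<Gamma>s) \<Psi>) \<and>
          (\<exists>u :: nat \<Rightarrow> nat \<Rightarrow> 'a.
             (\<forall>n\<ge>1. u n \<in> U \<and> D (u n) \<in> \<Gamma>d \<and>
                (\<forall>i\<in>{1..N}. degenerate_at (M i) (u n i) (D (u n) i)) \<and>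
                I (D (u n)) = A (u n) / B (u n)) \<and>
             filterlim (\<lambda>n. I (D (u n))) at_bot sequentially))"
proof -
  note single = assms(3) and A = assms(5) and B = assms(6) and sign = assms(9)
  define U where "U = space (PiM {1..N} M)"
  define S where "S = PiE {1..N} \<Gamma>"
  define T where "T = PiE {1..N} (\<lambda>i. degenerate_measures (M i))"
  define I where "I = linear_fractional N A B"
  define C where "C = test_function A B"
  define D where "D = dirac_collection N M"
  note defs = U_def S_def T_def I_def C_def D_def
  \<comment> \<open>The product \<sigma>-algebra depends only on the \<sigma>-algebras of the
    factors, so pointwise statements on \<open>U\<close> apply under every admissible product
    measure.\<close>
  have space: "space (PiM {1..N} \<Psi>) = U" if "\<Psi> \<in> S" for \<Psi>
    unfolding U_def using that assms(4)
    by (intro sets_eq_imp_space_eq sets_PiM_cong) (auto simp: S_def PiE_iff)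
  have prob: "prob_space (\<Psi> i)" if "\<Psi> \<in> S" "i \<in> {1..N}" for \<Psi> i
    using that assms(4) by (auto simp: S_def PiE_iff)
  have int: "integrable (PiM {1..N} \<Psi>) A" "integrable (PiM {1..N} \<Psi>) B" if "\<Psi> \<in> S" for \<Psi>
    using that assms(7) by (auto simp: S_def)
  have D_mem: "D u \<in> T" if "u \<in> U" for u
    using that dirac_collection_mem_degenerate[OF _ single] by (simp add: defs)
  have deg: "\<forall>i\<in>{1..N}. degenerate_at (M i) (u i) (D u i)" if "u \<in> U" for u
    unfolding D_def by (intro ballI degenerate_at_dirac_collection that[unfolded U_def] single)
  have T_subset: "T \<subseteq> S"
    unfolding S_def T_def by (intro PiE_mono assms(8))
  have I_D: "I (D u) = A u / B u" if "u \<in> U" for u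
    using that linear_fractional_dirac_collection[OF _ single A B] by (simp add: defs)
  have C: "C u = A u / B u" for u
    by (simp add: C_def test_function_def)
  have sign': "(\<forall>u\<in>space (PiM {1..N} \<Psi>). B u > 0) \<or> (\<forall>u\<in>space (PiM {1..N} \<Psi>). B u < 0)"
    if "\<Psi> \<in> S" for \<Psi>
    using sign by (simp only: space[OF that] U_def)
  have I_le: "I \<Psi> \<le> m" if \<Psi>: "\<Psi> \<in> S" and le: "\<And>u. u \<in> U \<Longrightarrow> C u \<le> m" for \<Psi> m
  proof -
    have "A u / B u \<le> m" if "u \<in> space (PiM {1..N} \<Psi>)" for u
      using le[of u] that unfolding space[OF \<Psi>] C by blast
    with prob[OF \<Psi>] int[OF \<Psi>] sign'[OF \<Psi>] show ?thesis
      unfolding I_def by (rule linear_fractional_le)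
  qed
  \<comment> \<open>This is the upper bound for the numerator \<open>- A\<close> over the same
    \<open>B\<close>; it supplies \<open>I_le\<close> for the negated pair.\<close>
  have I_ge: "- I \<Psi> \<le> m" if \<Psi>: "\<Psi> \<in> S" and le: "\<And>u. u \<in> U \<Longrightarrow> - C u \<le> m" for \<Psi> m
  proof -
    have "- A u / B u \<le> m" if "u \<in> space (PiM {1..N} \<Psi>)" for u
      using le[of u] that unfolding space[OF \<Psi>] C by simp
    with prob[OF \<Psi>] integrable_minus[OF int(1)[OF \<Psi>]] int(2)[OF \<Psi>] sign'[OF \<Psi>] show ?thesis
      unfolding I_def linear_fractional_uminus[symmetric] by (rule linear_fractional_le)
  qed
  have U_nonempty: "U \<noteq> {}"
    using assms(2) by (auto simp: U_def space_PiM PiE_eq_empty_iff)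
  interpret up: max_transfer I S T C U D
    by standard (use D_mem T_subset I_D C I_le U_nonempty in auto)
  \<comment> \<open>Upper bounds for the negated functions are lower bounds for \<open>I\<close> and
    \<open>C\<close>, so this instance yields every assertion on minima.\<close>
  interpret down: max_transfer "\<lambda>\<Psi>. - I \<Psi>" S T "\<lambda>u. - C u" U D
    by standard (use D_mem T_subset I_D C I_ge U_nonempty in auto)

  have max: "D u \<in> T \<and> (\<forall>i\<in>{1..N}. degenerate_at (M i) (u i) (D u i)) \<and>
      is_arg_max I (\<lambda>\<Psi>. \<Psi> \<in> S) (D u) \<and> is_max_value I S (I (D u)) \<and>
      is_max_value I T (I (D u)) \<and> is_max_value C U (I (D u)) \<and> I (D u) = A u / B u"
    if "is_arg_max C (\<lambda>v. v \<in> U) u" for u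
  proof -
    have "u \<in> U" using that by (simp add: is_arg_max_def)
    with D_mem deg I_D up.arg_max[OF that] show ?thesis by blast
  qed
  have min: "D u \<in> T \<and> (\<forall>i\<in>{1..N}. degenerate_at (M i) (u i) (D u i)) \<and>
      is_arg_min I (\<lambda>\<Psi>. \<Psi> \<in> S) (D u) \<and> is_min_value I S (I (D u)) \<and>
      is_min_value I T (I (D u)) \<and> is_min_value C U (I (D u)) \<and> I (D u) = A u / B u"
    if "is_arg_min C (\<lambda>v. v \<in> U) u" for u
  proof -
    have "u \<in> U" using that by (simp add: is_arg_min_def)
    with D_mem deg I_D down.arg_max[OF that[unfolded is_arg_min_iff_uminus]] show ?thesis
      unfolding is_arg_min_iff_uminus is_min_value_iff_uminus by blast
  qed
  have sup: "(\<exists>\<Psi>\<in>T. eps_optimal_max I S \<epsilon> \<Psi>) \<and>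
      (\<exists>u\<in>U. (SUP v\<in>U. C v) - \<epsilon> < C u \<and> C u < (SUP v\<in>U. C v)) \<and>
      (\<forall>u\<in>U. (SUP v\<in>U. C v) - \<epsilon> < C u \<and> C u < (SUP v\<in>U. C v) \<longrightarrow>
        D u \<in> T \<and> (\<forall>i\<in>{1..N}. degenerate_at (M i) (u i) (D u i)) \<and>
        eps_optimal_max I S \<epsilon> (D u))"
    if "bdd_above (C ` U)" "\<not> (\<exists>u. is_arg_max C (\<lambda>v. v \<in> U) u)" "\<epsilon> > 0" for \<epsilon>
    using up.near_SUP[OF that] up.eps_optimal[OF that(1)] D_mem deg by blast
  have inf: "(\<exists>\<Psi>\<in>T. eps_optimal_min I S \<epsilon> \<Psi>) \<and>
      (\<exists>u\<in>U. (INF v\<in>U. C v) < C u \<and> C u < (INF v\<in>U. C v) + \<epsilon>) \<and>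
      (\<forall>u\<in>U. (INF v\<in>U. C v) < C u \<and> C u < (INF v\<in>U. C v) + \<epsilon> \<longrightarrow>
        D u \<in> T \<and> (\<forall>i\<in>{1..N}. degenerate_at (M i) (u i) (D u i)) \<and>
        eps_optimal_min I S \<epsilon> (D u))"
    if "bdd_below (C ` U)" "\<not> (\<exists>u. is_arg_min C (\<lambda>v. v \<in> U) u)" "\<epsilon> > 0" for \<epsilon>
  proof -
    have bdd: "bdd_above ((\<lambda>u. - C u) ` U)"
      using that(1) by (simp add: bdd_above_uminus_image)
    \<comment> \<open>Negation carries the open interval of length \<epsilon> above the infimum of
      \<open>C\<close> to the one below the supremum of \<open>- C\<close>.\<close>
    have near: "(INF v\<in>U. C v) < C u \<and> C u < (INF v\<in>U. C v) + \<epsilon> \<longleftrightarrow>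
        (SUP v\<in>U. - C v) - \<epsilon> < - C u \<and> - C u < (SUP v\<in>U. - C v)" for u
      by (auto simp: INF_eq_uminus_SUP)
    show ?thesis
      unfolding near eps_optimal_min_iff_uminus
      using down.near_SUP[OF bdd that(2)[unfolded is_arg_min_iff_uminus] that(3)]
        down.eps_optimal[OF bdd] D_mem deg by blast
  qed
  have unbdd_above: "\<not> (\<exists>\<Psi>. is_arg_max I (\<lambda>\<Psi>. \<Psi> \<in> S) \<Psi>) \<and>
      (\<exists>u :: nat \<Rightarrow> nat \<Rightarrow> 'a. (\<forall>n\<ge>1. u n \<in> U \<and> D (u n) \<in> T \<and>
          (\<forall>i\<in>{1..N}. degenerate_at (M i) (u n i) (D (u n) i)) \<and>
          I (D (u n)) = A (u n) / B (u n)) \<and>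
        filterlim (\<lambda>n. I (D (u n))) at_top sequentially)"
    if "\<not> bdd_above (C ` U)"
    \<comment> \<open>The sequence found lies in \<open>U\<close> at every index from 0 on, in
      particular for \<open>n \<ge> 1\<close>.\<close>
    using up.no_arg_max[OF that] up.unbounded_sequence[OF that] D_mem deg I_D by blast
  have unbdd_below: "\<not> (\<exists>\<Psi>. is_arg_min I (\<lambda>\<Psi>. \<Psi> \<in> S) \<Psi>) \<and>
      (\<exists>u :: nat \<Rightarrow> nat \<Rightarrow> 'a. (\<forall>n\<ge>1. u n \<in> U \<and> D (u n) \<in> T \<and>
          (\<forall>i\<in>{1..N}. degenerate_at (M i) (u n i) (D (u n) i)) \<and>
          I (D (u n)) = A (u n) / B (u n)) \<and>
        filterlim (\<lambda>n. I (D (u n))) at_bot sequentially)"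
    if "\<not> bdd_below (C ` U)"
  proof -
    have unbdd: "\<not> bdd_above ((\<lambda>u. - C u) ` U)"
      using that by (simp add: bdd_above_uminus_image)
    show ?thesis
      unfolding is_arg_min_iff_uminus filterlim_uminus_at_bot
      using down.no_arg_max[OF unbdd] down.unbounded_sequence[OF unbdd] D_mem deg I_D by blast
  qed
  show ?thesis
    unfolding Let_def defs[symmetric]
    by (rule conjI, use max in blast, rule conjI, use min in blast, rule conjI, use sup in blast,
        rule conjI, use inf in blast, rule conjI, use unbdd_above in blast, use unbdd_below in blast)
qed

end
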